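(* Let $\mathcal{H}$ be a separable Hilbert space, let $W$ be a closed subspace of $\mathcal{H}$, and let $\mathcal{G}=\{g_j\}_{j\ge1}$ be a Bessel sequence in $\mathcal{H}$. Consider a dynamical system $(\mathcal{H},W,\mathcal{F},\mathcal{S})$ with any initial state $x_0\in\mathcal{H}$, and assume that $\mathcal{F}$ is linear. Then each source term $w\in W$ can be recovered from the measurements $\mathcal{D}(x_0,w)=[\langle x_n,g_j\rangle]_{n\ge0,\,j\ge1}$ in a stable way if and only if $\{\mathcal{S}^*g_j\}_{j\ge1}$ is a frame for $W$.
   Context: Hilbert spaces are complex. Dynamical system $(\mathcal{H},W,\mathcal{F},\mathcal{S})$: $\mathcal{F}=(\mathcal{F}_n)_{n\ge1}$ is a sequence of maps $\mathcal{F}_n:\mathcal{H}^n\times W\to\mathcal{H}$, and for an initial state $x_0\in\mathcal{H}$ and a source term $w\in W$ the states are defined recursively by $x_n=\mathcal{F}_n(x_0,\dots,x_{n-1},w)$, $n\ge1$. It is assumed that: (i) for each $w\in W$ there is a unique stationary state, i.e. a unique initial state $x_0(w)\in\mathcal{H}$ such that, starting at $x_0=x_0(w)$ with source $w$, one has $x_n=x_0(w)$ for all $n\ge1$; (ii) the mapping $\mathcal{S}:W\to\mathcal{H}$, $\mathcal{S}(w):=x_0(w)$, is a bounded linear operator (the stationary mapping operator); (iii) for any $w\in W$ and any initial state $x_0\in\mathcal{H}$, $\lim_{n\to\infty}x_n=\mathcal{S}(w)$ in the norm of $\mathcal{H}$. "$\mathcal{F}$ is linear" means that each $\mathcal{F}_n$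 is a linear map of its arguments $(x_0,\dots,x_{n-1},w)$. $\mathcal{S}^*:\mathcal{H}\to W$ is the Hilbert space adjoint of $\mathcal{S}$. A sequence $\{g_j\}_{j\ge1}$ in $\mathcal{H}$ is a Bessel sequence if there is $C<\infty$ with $\sum_{j}|\langle h,g_j\rangle|^2\le C\|h\|^2$ for all $h\in\mathcal{H}$. A sequence $\{f_j\}_{j\ge1}\subset W$ is a frame for $W$ if there are constants $0<c\le C<\infty$ with $c\|w\|^2\le\sum_j|\langle w,f_j\rangle|^2\le C\|w\|^2$ for all $w\in W$. The space $\mathcal{B}^{s}(\ell^2,\ell^\infty)$ is the set of infinite complex matrices whose rows $r_n$ belong to $\ell^2$ and for which there exists $t\in\ell^2$ with $\lim_{n\to\infty}\|r_n-t\|_{\ell^2}=0$, endowed with the norm $\sup_n\|r_n\|_{\ell^2}$. For data matrices of dynamical systems the rows are indexed by $n\ge0$ and the columns by $j\ge1$; the data matrices $\mathcal{D}(x_0,w)$ of such a system are regarded as elements of this space. Stable recovery (infinitely many iterations): the source term $w\in W$ can be recovered from $\mathcal{D}(x_0,w)$ in a stable way if there exists a bounded linear operator $\mathcal{R}:\mathcal{B}^s(\ell^2,\ell^\infty)\to\mathcal{H}$ such that $\mathcal{R}(\mathcal{D}(x_0,w))=w$ for all $x_0\in\mathcal{H}$ and all $w\in W$. *)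

theory Defs
  imports "HOL-Analysis.Analysis"
begin

(* The inner product is linear in the first argument. The norm, its completeness and the
   real scalar multiplication come from the class banach. *)
class complex_hilbert_space = banach +
  fixes scaleC :: "complex \<Rightarrow> 'a \<Rightarrow> 'a"  (infixr \<open>*\<^sub>C\<close> 75)
    and cinner :: "'a \<Rightarrow> 'a \<Rightarrow> complex"
  assumes scaleC_add_right: "a *\<^sub>C (x + y) = a *\<^sub>C x + a *\<^sub>C y"
    and scaleC_add_left: "(a + b) *\<^sub>C x = a *\<^sub>C x + b *\<^sub>C x"
    and scaleC_scaleC: "a *\<^sub>C (b *\<^sub>C x) = (a * b) *\<^sub>C x"
    and scaleR_scaleC: "r *\<^sub>R x = complex_of_real r *\<^sub>C x"
    and cinner_add_left: "cinner (x + y) z = cinner x z + cinner y z"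
    and cinner_scaleC_left: "cinner (a *\<^sub>C x) y = a * cinner x y"
    and cinner_commute: "cinner x y = cnj (cinner y x)"
    and cinner_self: "cinner x x = complex_of_real ((norm x)\<^sup>2)"

interpretation complex_vector:
  vector_space "scaleC :: complex \<Rightarrow> 'a \<Rightarrow> 'a::complex_hilbert_space"
proof
  fix x :: 'a
  have "1 *\<^sub>C x = 1 *\<^sub>R x"
    by (simp only: scaleR_scaleC of_real_1)
  then show "1 *\<^sub>C x = x" by simp
qed (simp_all add: scaleC_add_right scaleC_add_left scaleC_scaleC)

instantiation complex :: complex_hilbert_space
begin

definition scaleC_complex :: "complex \<Rightarrow> complex \<Rightarrow> complex"
  where "scaleC_complex a x = a * x"

definition cinner_complex :: "complex \<Rightarrow> complex \<Rightarrow> complex"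
  where "cinner_complex x y = x * cnj y"

instance
  by standard
    (auto simp: scaleC_complex_def cinner_complex_def algebra_simps scaleR_conv_of_real
      complex_norm_square simp flip: of_real_power)

end

(* Bounded (complex) linear operators whose domain is only the subspace W;
   values outside W are irrelevant. *)
definition bounded_clinear_on ::
  "'a::complex_hilbert_space set \<Rightarrow> ('a \<Rightarrow> 'b::complex_hilbert_space) \<Rightarrow> bool"
  where "bounded_clinear_on W T \<longleftrightarrow>
    (\<forall>u\<in>W. \<forall>v\<in>W. T (u + v) = T u + T v) \<and>
    (\<forall>a. \<forall>u\<in>W. T (a *\<^sub>C u) = a *\<^sub>C T u) \<and>
    (\<exists>K. \<forall>u\<in>W. norm (T u) \<le> K * norm u)"

(* The Hilbert space adjoint of T : W \<rightarrow> H, a map from H to W. For W a closed subspace and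
   T bounded linear on W, existence and uniqueness of v is the Riesz representation theorem. *)
definition adjoint_on ::
  "'a::complex_hilbert_space set \<Rightarrow> ('a \<Rightarrow> 'b::complex_hilbert_space) \<Rightarrow> 'b \<Rightarrow> 'a"
  where "adjoint_on W T h = (THE v. v \<in> W \<and> (\<forall>w\<in>W. cinner (T w) h = cinner w v))"


(* Sequences indexed by j \<ge> 1 are shifted to start at 0. *)

definition bessel_sequence :: "(nat \<Rightarrow> 'a::complex_hilbert_space) \<Rightarrow> bool"
  where "bessel_sequence g \<longleftrightarrow>
    (\<exists>C. \<forall>h. summable (\<lambda>j. (cmod (cinner h (g j)))\<^sup>2) \<and>
             (\<Sum>j. (cmod (cinner h (g j)))\<^sup>2) \<le> C * (norm h)\<^sup>2)"

definition frame_for :: "'a::complex_hilbert_space set \<Rightarrow> (nat \<Rightarrow> 'a) \<Rightarrow> bool"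
  where "frame_for W f \<longleftrightarrow>
    (\<forall>j. f j \<in> W) \<and>
    (\<exists>c C. 0 < c \<and> c \<le> C \<and>
      (\<forall>w\<in>W. summable (\<lambda>j. (cmod (cinner w (f j)))\<^sup>2) \<and>
              c * (norm w)\<^sup>2 \<le> (\<Sum>j. (cmod (cinner w (f j)))\<^sup>2) \<and>
              (\<Sum>j. (cmod (cinner w (f j)))\<^sup>2) \<le> C * (norm w)\<^sup>2))"


(* F n stands for the map F_n : H^n \<times> W \<rightarrow> H with n \<ge> 1; an element of H^n is a list of
   length n. The values of F n on lists of other lengths or outside W are irrelevant,
   as is F 0. *)

fun state :: "(nat \<Rightarrow> 'a list \<Rightarrow> 'a \<Rightarrow> 'a) \<Rightarrow> 'a \<Rightarrow> 'a \<Rightarrow> nat \<Rightarrow> 'a"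
  where "state F x0 w n = (if n = 0 then x0 else F n (map (state F x0 w) [0..<n]) w)"

declare state.simps [simp del]

definition stationary :: "(nat \<Rightarrow> 'a list \<Rightarrow> 'a \<Rightarrow> 'a) \<Rightarrow> 'a \<Rightarrow> 'a \<Rightarrow> bool"
  where "stationary F w x0 \<longleftrightarrow> (\<forall>n\<ge>1. state F x0 w n = x0)"

locale dynamical_system =
  fixes W :: "'a::complex_hilbert_space set"
    and F :: "nat \<Rightarrow> 'a list \<Rightarrow> 'a \<Rightarrow> 'a"
    and S :: "'a \<Rightarrow> 'a"
  assumes ex1_stationary: "w \<in> W \<Longrightarrow> \<exists>!x0. stationary F w x0"
    and stationary_S: "w \<in> W \<Longrightarrow> stationary F w (S w)"
    and bounded_clinear_S: "bounded_clinear_on W S"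
    and tendsto_S: "w \<in> W \<Longrightarrow> (\<lambda>n. state F x0 w n) \<longlonglongrightarrow> S w"

(* Each F_n is linear jointly in (x_0, ..., x_{n-1}, w) on H^n \<times> W. *)
definition linear_system ::
  "'a::complex_hilbert_space set \<Rightarrow> (nat \<Rightarrow> 'a list \<Rightarrow> 'a \<Rightarrow> 'a) \<Rightarrow> bool"
  where "linear_system W F \<longleftrightarrow> (\<forall>n\<ge>1.
    (\<forall>xs ys. \<forall>u\<in>W. \<forall>v\<in>W. length xs = n \<longrightarrow> length ys = n \<longrightarrow>
      F n (map2 (+) xs ys) (u + v) = F n xs u + F n ys v) \<and>
    (\<forall>a xs. \<forall>u\<in>W. length xs = n \<longrightarrow>
      F n (map ((*\<^sub>C) a) xs) (a *\<^sub>C u) = a *\<^sub>C F n xs u))"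

definition data_matrix ::
  "(nat \<Rightarrow> 'a list \<Rightarrow> 'a \<Rightarrow> 'a) \<Rightarrow> (nat \<Rightarrow> 'a::complex_hilbert_space) \<Rightarrow>
   'a \<Rightarrow> 'a \<Rightarrow> nat \<Rightarrow> nat \<Rightarrow> complex"
  where "data_matrix F g x0 w = (\<lambda>n j. cinner (state F x0 w n) (g j))"


definition ell2 :: "(nat \<Rightarrow> complex) set"
  where "ell2 = {r. summable (\<lambda>j. (cmod (r j))\<^sup>2)}"

definition ell2_norm :: "(nat \<Rightarrow> complex) \<Rightarrow> real"
  where "ell2_norm r = sqrt (\<Sum>j. (cmod (r j))\<^sup>2)"

definition Bs :: "(nat \<Rightarrow> nat \<Rightarrow> complex) set"
  where "Bs = {A. (\<forall>n. A n \<in> ell2) \<and>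
    (\<exists>t\<in>ell2. (\<lambda>n. ell2_norm (\<lambda>j. A n j - t j)) \<longlonglongrightarrow> 0)}"

(* The supremum is over a bounded set for A in Bs. *)
definition Bs_norm :: "(nat \<Rightarrow> nat \<Rightarrow> complex) \<Rightarrow> real"
  where "Bs_norm A = (SUP n. ell2_norm (A n))"

definition bounded_clinear_Bs ::
  "((nat \<Rightarrow> nat \<Rightarrow> complex) \<Rightarrow> 'a::complex_hilbert_space) \<Rightarrow> bool"
  where "bounded_clinear_Bs R \<longleftrightarrow>
    (\<forall>A\<in>Bs. \<forall>B\<in>Bs. R (\<lambda>n j. A n j + B n j) = R A + R B) \<and>
    (\<forall>a. \<forall>A\<in>Bs. R (\<lambda>n j. a * A n j) = a *\<^sub>C R A) \<and>
    (\<exists>K. \<forall>A\<in>Bs. norm (R A) \<le> K * Bs_norm A)"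

(* Membership of the data matrix in Bs only says that R, whose domain is Bs, may be applied
   to it; it is automatic when g is a Bessel sequence. *)
definition stably_recoverable ::
  "'a::complex_hilbert_space set \<Rightarrow> (nat \<Rightarrow> 'a list \<Rightarrow> 'a \<Rightarrow> 'a) \<Rightarrow> (nat \<Rightarrow> 'a) \<Rightarrow> bool"
  where "stably_recoverable W F g \<longleftrightarrow>
    (\<exists>R. bounded_clinear_Bs R \<and>
      (\<forall>x0. \<forall>w\<in>W. data_matrix F g x0 w \<in> Bs \<and> R (data_matrix F g x0 w) = w))"

end

theory Submission
  imports Defs
begin

text \<open>
  Along every orbit with source \<open>w\<close> the states converge to \<open>S w\<close>, so, \<open>g\<close> being a Bessel
  sequence, the rows of the data matrix converge in \<open>\<ell>\<^sup>2\<close> to the sequence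
  \<open>\<langle>S w, g j\<rangle> = \<langle>w, S\<^sup>* (g j)\<rangle>\<close>. This is the image of \<open>w\<close> under the analysis operator of
  \<open>f j = S\<^sup>* (g j)\<close>, whatever the initial state.

  If recovery is stable, feed the recovery operator with the orbit that starts in the stationary
  state. All rows of its data matrix are the analysis sequence of \<open>w\<close>, so boundedness of the
  operator is the lower frame inequality. The upper one always holds, because \<open>g\<close> is Bessel and
  \<open>S\<close> is bounded.

  Conversely, if \<open>f\<close> is a frame for \<open>W\<close>, the analysis operator has a bounded left inverse on all
  of \<open>\<ell>\<^sup>2\<close> (\<open>frame_left_inverse\<close>), and composing it with the map that sends a matrix to the limit of
  its rows recovers \<open>w\<close>. The left inverse maps \<open>t\<close> to its least squares solution, the \<open>w \<in> W\<close>
  with \<open>\<langle>A v, A w\<rangle> = \<langle>A v, t\<rangle>\<close> for all \<open>v \<in> W\<close>, where \<open>A\<close> is the analysis operator.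

  The least squares problem and the existence of \<open>S\<^sup>*\<close> are both instances of the Riesz
  representation theorem for a coercive Hermitian form on a closed subspace
  (\<open>coercive_form.riesz\<close>): for the form \<open>\<langle>A u, A v\<rangle>\<close>, coercive by the lower frame bound, and for
  the inner product itself.
\<close>

section \<open>Complex inner products\<close>

lemma cinner_add_right: "cinner x (y + z) = cinner x y + cinner x z"
  for x :: "'a::complex_hilbert_space"
  by (metis cinner_add_left cinner_commute complex_cnj_add)

lemma cinner_scaleC_right: "cinner x (a *\<^sub>C y) = cnj a * cinner x y"
  for x :: "'a::complex_hilbert_space"
  by (metis cinner_commute cinner_scaleC_left complex_cnj_mult)

lemma cinner_diff_left: "cinner (x - y) z = cinner x z - cinner y z"
  for x :: "'a::complex_hilbert_space"
  by (metis add_diff_cancel cinner_add_left diff_add_cancel)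

text \<open>The squared distance from \<open>x\<close> to its projection on the line through \<open>y\<close> is nonnegative.\<close>

lemma cinner_cauchy_schwarz: "cmod (cinner x y) \<le> norm x * norm y"
  for x :: "'a::complex_hilbert_space"
proof (cases "y = 0")
  case True
  have "cinner x 0 = 0"
    using cinner_add_right[of x 0 0] by simp
  then show ?thesis by (simp add: True)
next
  case False
  define N where "N = complex_of_real ((norm y)\<^sup>2)"
  define a where "a = cinner x y / N"
  have N: "N \<noteq> 0" "cnj N = N" "cinner y y = N"
    using False by (auto simp: N_def cinner_self)
  have "cinner (x - a *\<^sub>C y) (x - a *\<^sub>C y)
      = cinner x (x - a *\<^sub>C y) - a * cinner y (x - a *\<^sub>C y)"
    by (simp add: cinner_diff_left cinner_scaleC_left)
  also have "cinner y (x - a *\<^sub>C y) = 0"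
  proof -
    have "cinner (x - a *\<^sub>C y) y = 0"
      by (simp add: cinner_diff_left cinner_scaleC_left N a_def)
    then show ?thesis
      by (metis cinner_commute complex_cnj_zero)
  qed
  also have "cinner x (x - a *\<^sub>C y) = cinner x x - cnj a * cinner x y"
    by (metis add_diff_cancel_right' cinner_add_right cinner_scaleC_right diff_add_cancel)
  finally have "complex_of_real ((norm (x - a *\<^sub>C y))\<^sup>2)
      = complex_of_real ((norm x)\<^sup>2) - cinner x y * cnj (cinner x y) / N"
    by (simp add: cinner_self a_def N mult.commute)
  also have "\<dots> = complex_of_real ((norm x)\<^sup>2 - (cmod (cinner x y))\<^sup>2 / (norm y)\<^sup>2)"
    by (simp add: N_def complex_norm_square flip: of_real_power)
  finally have "0 \<le> (norm x)\<^sup>2 - (cmod (cinner x y))\<^sup>2 / (norm y)\<^sup>2"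
    by (metis of_real_eq_iff zero_le_power2)
  then have "(cmod (cinner x y))\<^sup>2 \<le> (norm x * norm y)\<^sup>2"
    using False by (simp add: field_simps)
  then show ?thesis
    by (rule power2_le_imp_le) simp
qed


section \<open>The Riesz representation theorem for coercive Hermitian forms\<close>

locale coercive_form =
  fixes W :: "'a::complex_hilbert_space set"
    and B :: "'a \<Rightarrow> 'a \<Rightarrow> complex"
    and c M :: real
  assumes subspace: "complex_vector.subspace W"
    and closed: "closed W"
    and add_left: "\<lbrakk>u \<in> W; v \<in> W; w \<in> W\<rbrakk> \<Longrightarrow> B (u + v) w = B u w + B v w"
    and scale_left: "\<lbrakk>u \<in> W; v \<in> W\<rbrakk> \<Longrightarrow> B (a *\<^sub>C u) v = a * B u v"
    and hermitian: "\<lbrakk>u \<in> W; v \<in> W\<rbrakk> \<Longrightarrow> B u v = cnj (B v u)"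
    and bounded: "\<lbrakk>u \<in> W; v \<in> W\<rbrakk> \<Longrightarrow> cmod (B u v) \<le> M * norm u * norm v"
    and coercive: "u \<in> W \<Longrightarrow> c * (norm u)\<^sup>2 \<le> Re (B u u)"
    and c_pos: "0 < c"
begin

lemmas W_add = complex_vector.subspace_add[OF subspace]
lemmas W_diff = complex_vector.subspace_diff[OF subspace]
lemmas W_scale = complex_vector.subspace_scale[OF subspace]

lemma W_scaleR: "u \<in> W \<Longrightarrow> r *\<^sub>R u \<in> W"
  by (simp add: scaleR_scaleC W_scale)

lemma diff_left: "\<lbrakk>u \<in> W; v \<in> W; w \<in> W\<rbrakk> \<Longrightarrow> B (u - v) w = B u w - B v w"
  using add_left[of "u - v" v w] W_diff by simp

lemma add_right: "\<lbrakk>u \<in> W; v \<in> W; w \<in> W\<rbrakk> \<Longrightarrow> B u (v + w) = B u v + B u w"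
  using add_left[of v w u] hermitian[of u "v + w"] hermitian[of u v] hermitian[of u w] W_add
  by simp

lemma diff_right: "\<lbrakk>u \<in> W; v \<in> W; w \<in> W\<rbrakk> \<Longrightarrow> B u (v - w) = B u v - B u w"
  using add_right[of u "v - w" w] W_diff by simp

lemma scale_right: "\<lbrakk>u \<in> W; v \<in> W\<rbrakk> \<Longrightarrow> B u (a *\<^sub>C v) = cnj a * B u v"
  using scale_left[of v u a] hermitian[of u "a *\<^sub>C v"] hermitian[of u v] W_scale by simp

lemma Re_commute: "\<lbrakk>u \<in> W; v \<in> W\<rbrakk> \<Longrightarrow> Re (B u v) = Re (B v u)"
  using hermitian[of u v] by simp

lemma scaleR_left: "\<lbrakk>u \<in> W; v \<in> W\<rbrakk> \<Longrightarrow> B (r *\<^sub>R u) v = complex_of_real r * B u v"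
  by (simp add: scaleR_scaleC scale_left)

lemma scaleR_right: "\<lbrakk>u \<in> W; v \<in> W\<rbrakk> \<Longrightarrow> B u (r *\<^sub>R v) = complex_of_real r * B u v"
  by (simp add: scaleR_scaleC scale_right)

lemma representer_unique:
  assumes "u \<in> W" "w \<in> W" and eq: "\<And>v. v \<in> W \<Longrightarrow> B v u = B v w"
  shows "u = w"
proof -
  have "B (u - w) (u - w) = 0"
    using assms eq[of "u - w"] by (simp add: diff_right W_diff)
  then have "c * (norm (u - w))\<^sup>2 \<le> 0"
    using coercive[of "u - w"] assms by (simp add: W_diff)
  then show ?thesis
    using c_pos by (simp add: mult_le_0_iff)
qed

text \<open>
  The representer is the minimiser of the energy \<open>B v v - 2 Re (\<phi> v)\<close>. Coercivity bounds the energy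
  from below, and with the parallelogram law it makes minimising sequences Cauchy. The Euler
  equation is obtained along a minimising sequence: the energy at \<open>u n + t v\<close> is at least the
  infimum, and letting \<open>n\<close> tend to infinity leaves a quadratic polynomial in \<open>t\<close> that is
  nonnegative and vanishes at \<open>0\<close>, so its linear coefficient is zero.
\<close>

theorem riesz:
  assumes \<phi>: "bounded_clinear_on W \<phi>"
  shows "\<exists>!w. w \<in> W \<and> (\<forall>v\<in>W. \<phi> v = B v w)"
proof -
  have \<phi>_add: "\<phi> (u + v) = \<phi> u + \<phi> v" if "u \<in> W" "v \<in> W" for u v
    using \<phi> that by (simp add: bounded_clinear_on_def)
  have \<phi>_scale: "\<phi> (a *\<^sub>C u) = a * \<phi> u" if "u \<in> W" for a u
    using \<phi> that by (simp add: bounded_clinear_on_def scaleC_complex_def)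
  have \<phi>_scaleR: "\<phi> (r *\<^sub>R u) = complex_of_real r * \<phi> u" if "u \<in> W" for r u
    using that by (simp add: scaleR_scaleC \<phi>_scale)
  obtain K where K: "cmod (\<phi> u) \<le> K * norm u" if "u \<in> W" for u
    using \<phi> unfolding bounded_clinear_on_def by blast
  define J where "J v = Re (B v v) - 2 * Re (\<phi> v)" for v
  have J_lower: "- (K\<^sup>2 / c) \<le> J v" if "v \<in> W" for v
  proof -
    have "Re (\<phi> v) \<le> K * norm v"
      using K[OF that] complex_Re_le_cmod[of "\<phi> v"] by linarith
    moreover have "0 \<le> c * (norm v - K / c)\<^sup>2"
      using c_pos by simp
    moreover have "c * (norm v - K / c)\<^sup>2 = c * (norm v)\<^sup>2 - 2 * (K * norm v) + K\<^sup>2 / c"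
      using c_pos by (simp add: field_simps power2_eq_square)
    ultimately show ?thesis
      using coercive[OF that] by (simp add: J_def)
  qed
  define m where "m = (INF v\<in>W. J v)"
  have W_ne: "W \<noteq> {}"
    using complex_vector.subspace_0[OF subspace] by auto
  have bdd: "bdd_below (J ` W)"
    using J_lower by (auto intro!: bdd_belowI2)
  have m_le: "m \<le> J v" if "v \<in> W" for v
    unfolding m_def using bdd that by (rule cINF_lower)
  have "\<exists>v\<in>W. J v < m + inverse (real (Suc n))" for n
    using cINF_less_iff[OF W_ne bdd, of "m + inverse (real (Suc n))"]
    by (simp flip: m_def)
  then obtain u where u: "u n \<in> W" "J (u n) < m + inverse (real (Suc n))" for n
    by metis
  have J_lim: "(\<lambda>n. J (u n)) \<longlonglongrightarrow> m"
  proof (rule tendsto_sandwich[OF _ _ tendsto_const])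
    show "(\<lambda>n. m + inverse (real (Suc n))) \<longlonglongrightarrow> m"
      using tendsto_add[OF tendsto_const LIMSEQ_inverse_real_of_nat] by simp
    show "\<forall>\<^sub>F n in sequentially. J (u n) \<le> m + inverse (real (Suc n))"
      using u(2) by (auto intro!: always_eventually less_imp_le)
  qed (auto intro!: always_eventually m_le u)
  have parallelogram: "c / 2 * (norm (x - y))\<^sup>2 \<le> J x + J y - 2 * m" if "x \<in> W" "y \<in> W" for x y
  proof -
    define z where "z = (1/2) *\<^sub>R (x + y)"
    have z: "z \<in> W"
      using that by (simp add: z_def W_add W_scaleR)
    have "4 * Re (B z z) = Re (B (x + y) (x + y))"
      using that by (simp add: z_def scaleR_left scaleR_right W_add W_scaleR Re_divide)
    moreover have "2 * Re (\<phi> z) = Re (\<phi> x) + Re (\<phi> y)"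
      using that by (simp add: z_def \<phi>_scaleR \<phi>_add W_add)
    moreover have "Re (B (x - y) (x - y)) + Re (B (x + y) (x + y))
        = 2 * Re (B x x) + 2 * Re (B y y)"
      using that by (simp add: add_left add_right diff_left diff_right W_add W_diff)
    ultimately have "J x + J y - 2 * J z = Re (B (x - y) (x - y)) / 2"
      by (simp add: J_def)
    then show ?thesis
      using coercive[of "x - y"] m_le[OF z] that by (simp add: W_diff)
  qed
  have "Cauchy u"
  proof (rule metric_CauchyI)
    fix e :: real assume "0 < e"
    then have pos: "0 < c * e\<^sup>2 / 4"
      using c_pos by simp
    obtain N where N: "J (u n) < m + c * e\<^sup>2 / 4" if "n \<ge> N" for n
      using order_tendstoD(2)[OF J_lim, of "m + c * e\<^sup>2 / 4"] pos
      unfolding eventually_sequentially by auto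
    show "\<exists>N. \<forall>i\<ge>N. \<forall>n\<ge>N. dist (u i) (u n) < e"
    proof (intro exI allI impI)
      fix i n assume "N \<le> i" "N \<le> n"
      then have "c / 2 * (norm (u i - u n))\<^sup>2 < c / 2 * e\<^sup>2"
        using N[of i] N[of n] parallelogram[of "u i" "u n"] u(1) by simp
      then have "(norm (u i - u n))\<^sup>2 < e\<^sup>2"
        using c_pos by simp
      then show "dist (u i) (u n) < e"
        using \<open>0 < e\<close> by (simp add: dist_norm power2_less_imp_less)
    qed
  qed
  then obtain w where w: "u \<longlonglongrightarrow> w"
    using Cauchy_convergent convergent_def by blast
  have wW: "w \<in> W"
    using closed u(1) w by (rule closed_sequentially)
  have real_part: "Re (B v w) = Re (\<phi> v)" if v: "v \<in> W" for v
  proof -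
    define d where "d = Re (B v w) - Re (\<phi> v)"
    define q where "q = Re (B v v)"
    have lim: "(\<lambda>n. B v (u n)) \<longlonglongrightarrow> B v w"
    proof (rule Lim_transform_bound[of _ "\<lambda>n. M * norm v * norm (u n - w)", THEN LIM_zero_cancel])
      show "\<forall>\<^sub>F n in sequentially. norm (B v (u n) - B v w) \<le> norm (M * norm v * norm (u n - w))"
        using bounded[OF v, of "u _ - w"] v u(1) wW
        by (auto intro!: always_eventually order_trans[OF _ abs_ge_self] simp: W_diff simp flip: diff_right)
      show "(\<lambda>n. M * norm v * norm (u n - w)) \<longlonglongrightarrow> 0"
        using w by (auto intro!: tendsto_mult_right_zero tendsto_norm_zero LIM_zero)
    qed
    have quad: "0 \<le> 2 * t * d + t\<^sup>2 * q" for t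
    proof -
      have "J (u n + t *\<^sub>R v) = J (u n) + 2 * t * (Re (B v (u n)) - Re (\<phi> v)) + t\<^sup>2 * q" for n
        using v u(1)[of n] Re_commute[OF v u(1)[of n]]
        by (simp add: J_def q_def add_left add_right scaleR_left scaleR_right W_add W_scaleR \<phi>_add
            \<phi>_scaleR algebra_simps power2_eq_square)
      then have "m \<le> J (u n) + 2 * t * (Re (B v (u n)) - Re (\<phi> v)) + t\<^sup>2 * q" for n
        using m_le[of "u n + t *\<^sub>R v"] v u(1) by (simp add: W_add W_scaleR)
      moreover have "(\<lambda>n. J (u n) + 2 * t * (Re (B v (u n)) - Re (\<phi> v)) + t\<^sup>2 * q)
          \<longlonglongrightarrow> m + 2 * t * d + t\<^sup>2 * q"
        unfolding d_def by (intro tendsto_intros J_lim lim)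
      ultimately have "m \<le> m + 2 * t * d + t\<^sup>2 * q"
        by (intro LIMSEQ_le_const) auto
      then show ?thesis by simp
    qed
    have "d = 0"
    proof (rule ccontr)
      assume "d \<noteq> 0"
      have "0 \<le> q"
        using coercive[OF v] c_pos unfolding q_def
        by (smt (verit) mult_nonneg_nonneg zero_le_power2)
      (* at this t the linear term outweighs the quadratic one *)
      define t where "t = - d / (q + 1)"
      have t: "t * (q + 1) = - d"
        using \<open>0 \<le> q\<close> by (simp add: t_def)
      have "2 * t * d + t\<^sup>2 * q = t * (t * (q + 1)) + 2 * t * d - t\<^sup>2"
        by (simp add: algebra_simps power2_eq_square)
      also have "\<dots> = t * d - t\<^sup>2"
        unfolding t by simp
      also have "t * d = - (d\<^sup>2) / (q + 1)"
        by (simp add: t_def power2_eq_square)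
      also have "\<dots> - t\<^sup>2 < 0"
        using \<open>d \<noteq> 0\<close> \<open>0 \<le> q\<close> by (smt (verit) divide_neg_pos zero_le_power2 zero_less_power2)
      finally show False
        using quad[of t] by simp
    qed
    then show ?thesis by (simp add: d_def)
  qed
  have "\<phi> v = B v w" if v: "v \<in> W" for v
  proof (rule complex_eqI)
    show "Re (\<phi> v) = Re (B v w)"
      using real_part[OF v] by simp
    (* Re (\<i> z) = - Im z *)
    show "Im (\<phi> v) = Im (B v w)"
      using real_part[OF W_scale[OF v, of \<i>]] v wW by (simp add: \<phi>_scale scale_left)
  qed
  moreover have "w' = w" if "w' \<in> W" "\<forall>v\<in>W. \<phi> v = B v w'" for w'
    using that wW calculation by (intro representer_unique) auto
  ultimately show ?thesis
    using wW by blast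
qed

end

lemma coercive_form_cinner:
  fixes W :: "'a::complex_hilbert_space set"
  assumes "complex_vector.subspace W" "closed W"
  shows "coercive_form W cinner 1 1"
proof (rule coercive_form.intro)
  show "cmod (cinner u v) \<le> 1 * norm u * norm v" for u v :: 'a
    using cinner_cauchy_schwarz[of u v] by simp
  show "1 * (norm u)\<^sup>2 \<le> Re (cinner u u)" for u :: 'a
    unfolding cinner_self by simp
  show "cinner (u + v) w = cinner u w + cinner v w" for u v w :: 'a
    by (rule cinner_add_left)
  show "cinner (a *\<^sub>C u) v = a * cinner u v" for a and u v :: 'a
    by (rule cinner_scaleC_left)
  show "cinner u v = cnj (cinner v u)" for u v :: 'a
    by (rule cinner_commute)
  show "complex_vector.subspace W" "closed W" "(0::real) < 1"
    using assms by auto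
qed

lemma adjoint_on:
  assumes "complex_vector.subspace W" "closed W" and T: "bounded_clinear_on W T"
  shows adjoint_on_mem: "adjoint_on W T h \<in> W"
    and cinner_adjoint_on: "w \<in> W \<Longrightarrow> cinner (T w) h = cinner w (adjoint_on W T h)"
proof -
  interpret coercive_form W cinner 1 1
    by (rule coercive_form_cinner[OF assms(1,2)])
  obtain K where K: "norm (T u) \<le> K * norm u" if "u \<in> W" for u
    using T unfolding bounded_clinear_on_def by blast
  have "cmod (cinner (T u) h) \<le> (K * norm h) * norm u" if "u \<in> W" for u
    using cinner_cauchy_schwarz[of "T u" h] mult_right_mono[OF K[OF that], of "norm h"]
    by (simp add: algebra_simps)
  then have "bounded_clinear_on W (\<lambda>w. cinner (T w) h)"
    using T unfolding bounded_clinear_on_def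
    by (auto simp: cinner_add_left cinner_scaleC_left scaleC_complex_def)
  from theI'[OF riesz[OF this]]
  show "adjoint_on W T h \<in> W" "w \<in> W \<Longrightarrow> cinner (T w) h = cinner w (adjoint_on W T h)"
    by (auto simp: adjoint_on_def)
qed


section \<open>Square-summable sequences\<close>

lemma L2_set_le_ell2_norm:
  assumes "r \<in> ell2"
  shows "L2_set (\<lambda>j. cmod (r j)) {..<n} \<le> ell2_norm r"
proof -
  have "(\<Sum>j<n. (cmod (r j))\<^sup>2) \<le> (\<Sum>j. (cmod (r j))\<^sup>2)"
    using assms unfolding ell2_def by (intro sum_le_suminf) auto
  then show ?thesis
    unfolding L2_set_def ell2_norm_def by (rule real_sqrt_le_mono)
qed

lemma ell2_norm_nonneg:
  assumes "r \<in> ell2"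
  shows "0 \<le> ell2_norm r"
  using L2_set_le_ell2_norm[OF assms, of 0] by simp

lemma ell2_norm_square:
  assumes "r \<in> ell2"
  shows "(ell2_norm r)\<^sup>2 = (\<Sum>j. (cmod (r j))\<^sup>2)"
  using ell2_norm_nonneg[OF assms] unfolding ell2_norm_def by simp

lemma ell2_boundedI:
  assumes "\<And>n. L2_set (\<lambda>j. cmod (r j)) {..<n} \<le> b"
  shows "r \<in> ell2" "ell2_norm r \<le> b"
proof -
  have b: "0 \<le> b"
    using assms[of 0] by simp
  have le: "(\<Sum>j<n. (cmod (r j))\<^sup>2) \<le> b\<^sup>2" for n
    using assms[of n] b by (auto simp: L2_set_def intro: sqrt_le_D)
  then have "summable (\<lambda>j. (cmod (r j))\<^sup>2)"
    by (intro summableI_nonneg_bounded) auto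
  moreover from this have "(\<Sum>j. (cmod (r j))\<^sup>2) \<le> b\<^sup>2"
    using le by (rule suminf_le_const)
  ultimately show "r \<in> ell2" "ell2_norm r \<le> b"
    using b by (auto simp: ell2_def ell2_norm_def intro: real_le_lsqrt suminf_nonneg)
qed

lemma ell2_add:
  assumes "r \<in> ell2" "s \<in> ell2"
  shows ell2_add_mem: "(\<lambda>j. r j + s j) \<in> ell2"
    and ell2_norm_triangle: "ell2_norm (\<lambda>j. r j + s j) \<le> ell2_norm r + ell2_norm s"
proof -
  have "L2_set (\<lambda>j. cmod (r j + s j)) {..<n} \<le> ell2_norm r + ell2_norm s" for n
  proof -
    have "L2_set (\<lambda>j. cmod (r j + s j)) {..<n} \<le> L2_set (\<lambda>j. cmod (r j) + cmod (s j)) {..<n}"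
      by (intro L2_set_mono norm_triangle_ineq) auto
    also have "\<dots> \<le> L2_set (\<lambda>j. cmod (r j)) {..<n} + L2_set (\<lambda>j. cmod (s j)) {..<n}"
      by (rule L2_set_triangle_ineq)
    also have "\<dots> \<le> ell2_norm r + ell2_norm s"
      using assms by (intro add_mono L2_set_le_ell2_norm)
    finally show ?thesis .
  qed
  then show "(\<lambda>j. r j + s j) \<in> ell2" "ell2_norm (\<lambda>j. r j + s j) \<le> ell2_norm r + ell2_norm s"
    by (rule ell2_boundedI)+
qed

lemma ell2_scale_mem: "r \<in> ell2 \<Longrightarrow> (\<lambda>j. a * r j) \<in> ell2"
  by (simp add: ell2_def norm_mult power_mult_distrib summable_mult)

lemma ell2_diff_mem: "\<lbrakk>r \<in> ell2; s \<in> ell2\<rbrakk> \<Longrightarrow> (\<lambda>j. r j - s j) \<in> ell2"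
  using ell2_add_mem[of r "\<lambda>j. - 1 * s j"] ell2_scale_mem[of s "- 1"] by simp

lemma norm_le_ell2_norm:
  assumes "r \<in> ell2"
  shows "cmod (r j) \<le> ell2_norm r"
proof -
  have "cmod (r j) \<le> L2_set (\<lambda>j. cmod (r j)) {..<Suc j}"
    by (rule member_le_L2_set) auto
  then show ?thesis
    using L2_set_le_ell2_norm[OF assms, of "Suc j"] by linarith
qed

definition ell2_inner :: "(nat \<Rightarrow> complex) \<Rightarrow> (nat \<Rightarrow> complex) \<Rightarrow> complex"
  where "ell2_inner r s = (\<Sum>j. r j * cnj (s j))"

lemma ell2_cauchy_schwarz:
  assumes "r \<in> ell2" "s \<in> ell2"
  shows summable_ell2_inner: "summable (\<lambda>j. r j * cnj (s j))"
    and norm_ell2_inner: "cmod (ell2_inner r s) \<le> ell2_norm r * ell2_norm s"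
proof -
  have le: "(\<Sum>j<n. cmod (r j * cnj (s j))) \<le> ell2_norm r * ell2_norm s" for n
  proof -
    have "(\<Sum>j<n. cmod (r j * cnj (s j))) = (\<Sum>j<n. \<bar>cmod (r j)\<bar> * \<bar>cmod (s j)\<bar>)"
      by (simp add: norm_mult)
    also have "\<dots> \<le> L2_set (\<lambda>j. cmod (r j)) {..<n} * L2_set (\<lambda>j. cmod (s j)) {..<n}"
      by (rule L2_set_mult_ineq)
    also have "\<dots> \<le> ell2_norm r * ell2_norm s"
      using assms by (intro mult_mono L2_set_le_ell2_norm ell2_norm_nonneg) auto
    finally show ?thesis .
  qed
  then have summable: "summable (\<lambda>j. cmod (r j * cnj (s j)))"
    by (intro summableI_nonneg_bounded) auto
  then show "summable (\<lambda>j. r j * cnj (s j))"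
    by (rule summable_norm_cancel)
  show "cmod (ell2_inner r s) \<le> ell2_norm r * ell2_norm s"
    unfolding ell2_inner_def using summable_norm[OF summable] suminf_le_const[OF summable le]
    by linarith
qed

lemma ell2_inner_add_left:
  "\<lbrakk>r \<in> ell2; s \<in> ell2; t \<in> ell2\<rbrakk> \<Longrightarrow>
    ell2_inner (\<lambda>j. r j + s j) t = ell2_inner r t + ell2_inner s t"
  by (simp add: ell2_inner_def ring_distribs suminf_add summable_ell2_inner)

lemma ell2_inner_add_right:
  "\<lbrakk>r \<in> ell2; s \<in> ell2; t \<in> ell2\<rbrakk> \<Longrightarrow>
    ell2_inner r (\<lambda>j. s j + t j) = ell2_inner r s + ell2_inner r t"
  by (simp add: ell2_inner_def ring_distribs suminf_add summable_ell2_inner)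

lemma ell2_inner_scale_left:
  "\<lbrakk>r \<in> ell2; s \<in> ell2\<rbrakk> \<Longrightarrow> ell2_inner (\<lambda>j. a * r j) s = a * ell2_inner r s"
  by (simp add: ell2_inner_def mult.assoc suminf_mult summable_ell2_inner)

lemma ell2_inner_scale_right:
  "\<lbrakk>r \<in> ell2; s \<in> ell2\<rbrakk> \<Longrightarrow> ell2_inner r (\<lambda>j. a * s j) = cnj a * ell2_inner r s"
  by (simp add: ell2_inner_def mult.left_commute suminf_mult summable_ell2_inner)

lemma ell2_inner_commute:
  assumes "r \<in> ell2" "s \<in> ell2"
  shows "ell2_inner r s = cnj (ell2_inner s r)"
proof -
  have "(\<lambda>j. cnj (s j * cnj (r j))) sums cnj (ell2_inner s r)"
    unfolding sums_cnj ell2_inner_def using assms by (intro summable_sums summable_ell2_inner)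
  then show ?thesis
    by (simp add: ell2_inner_def sums_iff mult.commute)
qed

lemma ell2_inner_self:
  assumes "r \<in> ell2"
  shows "ell2_inner r r = complex_of_real ((ell2_norm r)\<^sup>2)"
proof -
  have "summable (\<lambda>j. (cmod (r j))\<^sup>2)"
    using assms by (simp add: ell2_def)
  then have "(\<lambda>j. complex_of_real ((cmod (r j))\<^sup>2)) sums complex_of_real ((ell2_norm r)\<^sup>2)"
    unfolding ell2_norm_square[OF assms] by (intro sums_of_real summable_sums)
  then show ?thesis
    unfolding ell2_inner_def complex_norm_square by (rule sums_unique[symmetric])
qed


section \<open>Frames and their least squares left inverse\<close>

definition analysis :: "(nat \<Rightarrow> 'a::complex_hilbert_space) \<Rightarrow> 'a \<Rightarrow> nat \<Rightarrow> complex"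
  where "analysis f w = (\<lambda>j. cinner w (f j))"

lemma analysis_add: "analysis f (u + v) = (\<lambda>j. analysis f u j + analysis f v j)"
  by (simp add: analysis_def cinner_add_left)

lemma analysis_diff: "analysis f (u - v) = (\<lambda>j. analysis f u j - analysis f v j)"
  by (simp add: analysis_def cinner_diff_left)

lemma analysis_scale: "analysis f (a *\<^sub>C u) = (\<lambda>j. a * analysis f u j)"
  by (simp add: analysis_def cinner_scaleC_left)

lemma bessel_sequence_analysis:
  assumes "bessel_sequence g"
  obtains K where "0 \<le> K" "\<And>h. analysis g h \<in> ell2"
    "\<And>h. ell2_norm (analysis g h) \<le> K * norm h"
proof -
  obtain C where C: "summable (\<lambda>j. (cmod (cinner h (g j)))\<^sup>2)"
      "(\<Sum>j. (cmod (cinner h (g j)))\<^sup>2) \<le> C * (norm h)\<^sup>2" for h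
    using assms unfolding bessel_sequence_def by blast
  have "ell2_norm (analysis g h) \<le> sqrt \<bar>C\<bar> * norm h" for h
  proof -
    have "ell2_norm (analysis g h) \<le> sqrt (\<bar>C\<bar> * (norm h)\<^sup>2)"
      unfolding ell2_norm_def analysis_def
      using order_trans[OF C(2)[of h] mult_right_mono[OF abs_ge_self[of C] zero_le_power2]]
      by (rule real_sqrt_le_mono)
    then show ?thesis by (simp add: real_sqrt_mult)
  qed
  moreover have "analysis g h \<in> ell2" for h
    using C(1) by (simp add: ell2_def analysis_def)
  ultimately show thesis
    by (intro that[of "sqrt \<bar>C\<bar>"]) auto
qed

lemma frame_for_iff:
  "frame_for W f \<longleftrightarrow> (\<forall>j. f j \<in> W) \<and>
    (\<exists>c>0. \<exists>K\<ge>0. \<forall>w\<in>W. analysis f w \<in> ell2 \<and> c * norm w \<le> ell2_norm (analysis f w) \<and>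
      ell2_norm (analysis f w) \<le> K * norm w)"
  (is "?L \<longleftrightarrow> ?R")
proof
  assume ?L
  then obtain c C where fW: "\<forall>j. f j \<in> W" and c: "0 < c" "c \<le> C"
    and *: "\<forall>w\<in>W. summable (\<lambda>j. (cmod (cinner w (f j)))\<^sup>2) \<and>
              c * (norm w)\<^sup>2 \<le> (\<Sum>j. (cmod (cinner w (f j)))\<^sup>2) \<and>
              (\<Sum>j. (cmod (cinner w (f j)))\<^sup>2) \<le> C * (norm w)\<^sup>2"
    unfolding frame_for_def by blast
  have "analysis f w \<in> ell2 \<and> sqrt c * norm w \<le> ell2_norm (analysis f w) \<and>
      ell2_norm (analysis f w) \<le> sqrt C * norm w" if "w \<in> W" for w
  proof -
    have "sqrt (c * (norm w)\<^sup>2) \<le> ell2_norm (analysis f w)"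
      "ell2_norm (analysis f w) \<le> sqrt (C * (norm w)\<^sup>2)"
      unfolding ell2_norm_def analysis_def using * that by (auto intro!: real_sqrt_le_mono)
    then show ?thesis
      using * that by (simp add: real_sqrt_mult ell2_def analysis_def)
  qed
  moreover have "0 < sqrt c" "0 \<le> sqrt C"
    using c by auto
  ultimately show ?R
    using fW by blast
next
  assume ?R
  then obtain c K where fW: "\<forall>j. f j \<in> W" and c: "0 < c" "0 \<le> K"
    and *: "\<And>w. w \<in> W \<Longrightarrow> analysis f w \<in> ell2"
      "\<And>w. w \<in> W \<Longrightarrow> c * norm w \<le> ell2_norm (analysis f w)"
      "\<And>w. w \<in> W \<Longrightarrow> ell2_norm (analysis f w) \<le> K * norm w"
    by blast
  (* on W = {0} nothing relates K to c, hence the maximum *)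
  define C where "C = max (c\<^sup>2) (K\<^sup>2)"
  have "summable (\<lambda>j. (cmod (cinner w (f j)))\<^sup>2) \<and>
      c\<^sup>2 * (norm w)\<^sup>2 \<le> (\<Sum>j. (cmod (cinner w (f j)))\<^sup>2) \<and>
      (\<Sum>j. (cmod (cinner w (f j)))\<^sup>2) \<le> C * (norm w)\<^sup>2" if w: "w \<in> W" for w
  proof -
    have "(c * norm w)\<^sup>2 \<le> (ell2_norm (analysis f w))\<^sup>2"
      using *[OF w] c by (intro power_mono) auto
    moreover have "(ell2_norm (analysis f w))\<^sup>2 \<le> (K * norm w)\<^sup>2"
      using *[OF w] by (intro power_mono ell2_norm_nonneg) auto
    moreover have "K\<^sup>2 * (norm w)\<^sup>2 \<le> C * (norm w)\<^sup>2"
      by (intro mult_right_mono) (auto simp: C_def)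
    moreover have "(ell2_norm (analysis f w))\<^sup>2 = (\<Sum>j. (cmod (cinner w (f j)))\<^sup>2)"
      using *(1)[OF w] by (simp add: ell2_norm_square) (simp add: analysis_def)
    ultimately show ?thesis
      using *(1)[OF w] by (simp add: power_mult_distrib ell2_def analysis_def)
  qed
  moreover have "0 < c\<^sup>2" "c\<^sup>2 \<le> C"
    using c by (auto simp: C_def)
  ultimately show ?L
    using fW unfolding frame_for_def by blast
qed

text \<open>
  For square-summable \<open>t\<close> the normal equations \<open>\<langle>A v, A w\<rangle> = \<langle>A v, t\<rangle>\<close>, \<open>v \<in> W\<close>, have a unique
  solution \<open>w \<in> W\<close>, since the frame bounds say that \<open>\<langle>A u, A v\<rangle>\<close> is a coercive bounded form on \<open>W\<close>.
  Uniqueness makes the solution linear in \<open>t\<close> and equal to \<open>w\<close> for \<open>t = A w\<close>; the case \<open>v = w\<close>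
  yields \<open>\<parallel>A w\<parallel> \<le> \<parallel>t\<parallel>\<close> and hence boundedness.
\<close>

lemma frame_left_inverse:
  fixes f :: "nat \<Rightarrow> 'a::complex_hilbert_space"
  assumes W: "complex_vector.subspace W" "closed W" and frame: "frame_for W f"
  obtains L :: "(nat \<Rightarrow> complex) \<Rightarrow> 'a" and k :: real
  where "\<And>r s. \<lbrakk>r \<in> ell2; s \<in> ell2\<rbrakk> \<Longrightarrow> L (\<lambda>j. r j + s j) = L r + L s"
    and "\<And>a r. r \<in> ell2 \<Longrightarrow> L (\<lambda>j. a * r j) = a *\<^sub>C L r"
    and "0 \<le> k" and "\<And>r. r \<in> ell2 \<Longrightarrow> norm (L r) \<le> k * ell2_norm r"
    and "\<And>w. w \<in> W \<Longrightarrow> L (analysis f w) = w"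
proof -
  obtain c K where c: "0 < c" "0 \<le> K"
    and A: "\<And>w. w \<in> W \<Longrightarrow> analysis f w \<in> ell2"
    and lower: "\<And>w. w \<in> W \<Longrightarrow> c * norm w \<le> ell2_norm (analysis f w)"
    and upper: "\<And>w. w \<in> W \<Longrightarrow> ell2_norm (analysis f w) \<le> K * norm w"
    using frame unfolding frame_for_iff by blast
  define B where "B u v = ell2_inner (analysis f u) (analysis f v)" for u v
  interpret coercive_form W B "c\<^sup>2" "K\<^sup>2"
  proof
    fix u v assume uv: "u \<in> W" "v \<in> W"
    have "cmod (B u v) \<le> ell2_norm (analysis f u) * ell2_norm (analysis f v)"
      unfolding B_def using uv by (intro norm_ell2_inner A)
    also have "\<dots> \<le> (K * norm u) * (K * norm v)"
      using uv c by (intro mult_mono upper ell2_norm_nonneg A) auto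
    finally show "cmod (B u v) \<le> K\<^sup>2 * norm u * norm v"
      by (simp add: power2_eq_square algebra_simps)
  next
    fix u assume u: "u \<in> W"
    have "(c * norm u)\<^sup>2 \<le> (ell2_norm (analysis f u))\<^sup>2"
      using lower[OF u] c by (intro power_mono) auto
    then show "c\<^sup>2 * (norm u)\<^sup>2 \<le> Re (B u u)"
      using A[OF u] by (simp add: B_def ell2_inner_self power_mult_distrib)
  next
    fix u v assume "u \<in> W" "v \<in> W"
    then show "B u v = cnj (B v u)"
      unfolding B_def by (intro ell2_inner_commute A)
  qed (use W c A in \<open>simp_all add: B_def analysis_add analysis_scale ell2_inner_add_left
      ell2_inner_scale_left\<close>)
  define P where "P t w \<longleftrightarrow> w \<in> W \<and> (\<forall>v\<in>W. ell2_inner (analysis f v) t = B v w)" for t w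
  have ex: "\<exists>!w. P t w" if t: "t \<in> ell2" for t
    unfolding P_def
  proof (rule riesz)
    have "cmod (ell2_inner (analysis f u) t) \<le> (K * ell2_norm t) * norm u" if "u \<in> W" for u
      using norm_ell2_inner[OF A[OF that] t] mult_right_mono[OF upper[OF that] ell2_norm_nonneg[OF t]]
      by (simp add: algebra_simps)
    then show "bounded_clinear_on W (\<lambda>v. ell2_inner (analysis f v) t)"
      using A t unfolding bounded_clinear_on_def
      by (auto simp: analysis_add analysis_scale ell2_inner_add_left ell2_inner_scale_left
          scaleC_complex_def)
  qed
  define L where "L t = (THE w. P t w)" for t
  have L: "P t (L t)" if "t \<in> ell2" for t
    unfolding L_def using ex[OF that] by (rule theI')
  have L_eq: "L t = w" if "t \<in> ell2" "P t w" for t w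
    using ex[OF that(1)] that(2) L[OF that(1)] by blast
  show thesis
  proof
    fix r s :: "nat \<Rightarrow> complex" assume rs: "r \<in> ell2" "s \<in> ell2"
    then have "P (\<lambda>j. r j + s j) (L r + L s)"
      using L[of r] L[of s] A by (auto simp: P_def W_add add_right ell2_inner_add_right)
    with rs show "L (\<lambda>j. r j + s j) = L r + L s"
      by (intro L_eq ell2_add_mem)
  next
    fix a and r :: "nat \<Rightarrow> complex" assume r: "r \<in> ell2"
    then have "P (\<lambda>j. a * r j) (a *\<^sub>C L r)"
      using L[of r] A by (auto simp: P_def W_scale scale_right ell2_inner_scale_right)
    with r show "L (\<lambda>j. a * r j) = a *\<^sub>C L r"
      by (intro L_eq ell2_scale_mem)
  next
    fix r :: "nat \<Rightarrow> complex" assume r: "r \<in> ell2"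
    define w where "w = L r"
    have w: "w \<in> W" "ell2_inner (analysis f w) r = B w w"
      using L[OF r] by (auto simp: P_def w_def)
    define N where "N = ell2_norm (analysis f w)"
    have "N * N = cmod (B w w)"
      using A[OF w(1)] by (simp add: N_def B_def ell2_inner_self power2_eq_square norm_mult)
    also have "\<dots> \<le> N * ell2_norm r"
      using norm_ell2_inner[OF A[OF w(1)] r] w(2) by (simp add: N_def)
    finally have "N \<le> ell2_norm r"
      using ell2_norm_nonneg[OF r] ell2_norm_nonneg[OF A[OF w(1)]]
      by (cases "N = 0") (auto simp: N_def)
    then show "norm (L r) \<le> inverse c * ell2_norm r"
      using lower[OF w(1)] c by (simp add: N_def w_def field_simps)
  next
    fix w assume "w \<in> W"
    then show "L (analysis f w) = w"
      using A by (intro L_eq) (auto simp: P_def B_def)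
  next
    show "0 \<le> inverse c"
      using c by simp
  qed
qed


section \<open>Matrices with convergent rows\<close>

text \<open>Convergence in \<open>\<ell>\<^sup>2\<close> forces convergence of entries, so the limit row can be taken entrywise.\<close>

definition row_limit :: "(nat \<Rightarrow> nat \<Rightarrow> complex) \<Rightarrow> nat \<Rightarrow> complex"
  where "row_limit A = (\<lambda>j. lim (\<lambda>n. A n j))"

lemma tendsto_entry:
  assumes A: "\<And>n. A n \<in> ell2" and t: "t \<in> ell2"
    and lim: "(\<lambda>n. ell2_norm (\<lambda>j. A n j - t j)) \<longlonglongrightarrow> 0"
  shows "(\<lambda>n. A n j) \<longlonglongrightarrow> t j"
proof -
  have "(\<lambda>n. A n j - t j) \<longlonglongrightarrow> 0"
    using norm_le_ell2_norm[OF ell2_diff_mem[OF A t]]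
    by (intro Lim_null_comparison[OF _ lim]) (auto intro!: always_eventually)
  then show ?thesis
    by (rule LIM_zero_cancel)
qed

lemma row_limit_eq:
  assumes "\<And>n. A n \<in> ell2" "t \<in> ell2" "(\<lambda>n. ell2_norm (\<lambda>j. A n j - t j)) \<longlonglongrightarrow> 0"
  shows "row_limit A = t"
  unfolding row_limit_def using tendsto_entry[OF assms] by (intro ext limI)

lemma Bs_row_limit:
  assumes "A \<in> Bs"
  shows Bs_row: "A n \<in> ell2"
    and row_limit_mem: "row_limit A \<in> ell2"
    and tendsto_row_limit: "(\<lambda>n. ell2_norm (\<lambda>j. A n j - row_limit A j)) \<longlonglongrightarrow> 0"
proof -
  obtain t where t: "t \<in> ell2" "(\<lambda>n. ell2_norm (\<lambda>j. A n j - t j)) \<longlonglongrightarrow> 0"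
    using assms by (auto simp: Bs_def)
  show A: "A n \<in> ell2" for n
    using assms by (auto simp: Bs_def)
  show "row_limit A \<in> ell2" "(\<lambda>n. ell2_norm (\<lambda>j. A n j - row_limit A j)) \<longlonglongrightarrow> 0"
    using t row_limit_eq[OF A t] by auto
qed

lemma row_limit_entry:
  assumes "A \<in> Bs"
  shows "(\<lambda>n. A n j) \<longlonglongrightarrow> row_limit A j"
  using Bs_row[OF assms] row_limit_mem[OF assms] tendsto_row_limit[OF assms]
  by (rule tendsto_entry)

lemma row_limit_add:
  assumes "A \<in> Bs" "B \<in> Bs"
  shows "row_limit (\<lambda>n j. A n j + B n j) = (\<lambda>j. row_limit A j + row_limit B j)"
proof
  fix j
  have "(\<lambda>n. A n j + B n j) \<longlonglongrightarrow> row_limit A j + row_limit B j"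
    by (rule tendsto_add[OF row_limit_entry[OF assms(1)] row_limit_entry[OF assms(2)]])
  then show "row_limit (\<lambda>n j. A n j + B n j) j = row_limit A j + row_limit B j"
    unfolding row_limit_def[of "\<lambda>n j. A n j + B n j"] by (rule limI)
qed

lemma row_limit_scale:
  assumes "A \<in> Bs"
  shows "row_limit (\<lambda>n j. a * A n j) = (\<lambda>j. a * row_limit A j)"
proof
  fix j
  have "(\<lambda>n. a * A n j) \<longlonglongrightarrow> a * row_limit A j"
    by (rule tendsto_mult_left[OF row_limit_entry[OF assms]])
  then show "row_limit (\<lambda>n j. a * A n j) j = a * row_limit A j"
    unfolding row_limit_def[of "\<lambda>n j. a * A n j"] by (rule limI)
qed

lemma norm_row_limit:
  assumes A: "A \<in> Bs"
  shows "ell2_norm (row_limit A) \<le> Bs_norm A"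
proof -
  define t where "t = row_limit A"
  define d where "d n = ell2_norm (\<lambda>j. A n j - t j)" for n
  note row = Bs_row[OF A] and t = row_limit_mem[OF A, folded t_def]
  have d: "d \<longlonglongrightarrow> 0"
    using tendsto_row_limit[OF A] by (simp add: d_def[abs_def] t_def)
  have row_le: "ell2_norm (A n) \<le> d n + ell2_norm t" for n
    using ell2_norm_triangle[OF ell2_diff_mem[OF row[of n] t] t] by (simp add: d_def)
  have t_le: "ell2_norm t \<le> d n + ell2_norm (A n)" for n
    using ell2_norm_triangle[OF ell2_diff_mem[OF t row[of n]] row[of n]]
    by (simp add: d_def ell2_norm_def norm_minus_commute)
  have "Bseq d"
    using d by (intro convergent_imp_Bseq convergentI)
  then obtain b where b: "\<And>n. \<bar>d n\<bar> \<le> b"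
    by (auto simp: Bseq_def)
  have "ell2_norm (A n) \<le> b + ell2_norm t" for n
    using row_le[of n] b[of n] by linarith
  then have "ell2_norm (A n) \<le> Bs_norm A" for n
    unfolding Bs_norm_def by (intro cSUP_upper bdd_aboveI2) auto
  then have "ell2_norm t \<le> d n + Bs_norm A" for n
    using t_le[of n] by (meson add_left_mono order_trans)
  moreover have "(\<lambda>n. d n + Bs_norm A) \<longlonglongrightarrow> 0 + Bs_norm A"
    by (intro tendsto_add d tendsto_const)
  ultimately show ?thesis
    unfolding t_def[symmetric] by (intro LIMSEQ_le_const) auto
qed


section \<open>Recovery of the source term\<close>

lemma data_matrix_row_limit:
  assumes system: "dynamical_system W F S" and bessel: "bessel_sequence g" and w: "w \<in> W"
  shows data_matrix_mem_Bs: "data_matrix F g x0 w \<in> Bs"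
    and row_limit_data_matrix: "row_limit (data_matrix F g x0 w) = analysis g (S w)"
proof -
  obtain K where K: "analysis g h \<in> ell2" "ell2_norm (analysis g h) \<le> K * norm h" for h
    using bessel_sequence_analysis[OF bessel] by metis
  have row: "data_matrix F g x0 w n = analysis g (state F x0 w n)" for n
    by (simp add: data_matrix_def analysis_def)
  have "(\<lambda>n. K * norm (state F x0 w n - S w)) \<longlonglongrightarrow> 0"
    using dynamical_system.tendsto_S[OF system w]
    by (intro tendsto_mult_right_zero tendsto_norm_zero LIM_zero)
  then have lim: "(\<lambda>n. ell2_norm (\<lambda>j. data_matrix F g x0 w n j - analysis g (S w) j)) \<longlonglongrightarrow> 0"
    unfolding row analysis_diff[symmetric]
    by (rule Lim_null_comparison[rotated]) (use K ell2_norm_nonneg in \<open>auto intro!: always_eventually\<close>)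
  show "data_matrix F g x0 w \<in> Bs"
    using lim K(1) by (auto simp: Bs_def row)
  show "row_limit (data_matrix F g x0 w) = analysis g (S w)"
    using lim K(1) by (intro row_limit_eq) (auto simp: row)
qed

theorem theorem3p4:
  fixes W :: "'h::complex_hilbert_space set"
    and F :: "nat \<Rightarrow> 'h list \<Rightarrow> 'h \<Rightarrow> 'h"
    and S :: "'h \<Rightarrow> 'h"
    and g :: "nat \<Rightarrow> 'h"
  assumes separable: "separable_space (euclidean :: 'h topology)"
    and subspace_W: "complex_vector.subspace W"
    and closed_W: "closed W"
    and bessel: "bessel_sequence g"
    and system: "dynamical_system W F S"
    and linear: "linear_system W F"
  shows "stably_recoverable W F g \<longleftrightarrow> frame_for W (\<lambda>j. adjoint_on W S (g j))"
proof -
  interpret dynamical_system W F S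
    by (rule system)
  define f where "f = (\<lambda>j. adjoint_on W S (g j))"
  have fW: "\<forall>j. f j \<in> W"
    unfolding f_def using subspace_W closed_W bounded_clinear_S by (auto intro: adjoint_on_mem)
  have analysis_S: "analysis g (S w) = analysis f w" if "w \<in> W" for w
    unfolding analysis_def f_def
    using subspace_W closed_W bounded_clinear_S that by (intro ext cinner_adjoint_on)
  have "frame_for W f" if "stably_recoverable W F g"
  proof -
    obtain R K where R: "\<And>A. A \<in> Bs \<Longrightarrow> norm (R A) \<le> K * Bs_norm A"
        "\<And>x0 w. w \<in> W \<Longrightarrow> R (data_matrix F g x0 w) = w"
      using \<open>stably_recoverable W F g\<close>
      unfolding stably_recoverable_def bounded_clinear_Bs_def by blast
    obtain C where C: "0 \<le> C" "analysis g h \<in> ell2" "ell2_norm (analysis g h) \<le> C * norm h" for h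
      using bessel_sequence_analysis[OF bessel] by metis
    obtain M where M: "norm (S w) \<le> M * norm w" if "w \<in> W" for w
      using bounded_clinear_S unfolding bounded_clinear_on_def by blast
    have ell2: "analysis f w \<in> ell2" if "w \<in> W" for w
      using C(2)[of "S w"] analysis_S[OF that] by simp
    have lower: "inverse (\<bar>K\<bar> + 1) * norm w \<le> ell2_norm (analysis f w)" if w: "w \<in> W" for w
    proof -
      have "state F (S w) w n = S w" for n
        using stationary_S[OF w] unfolding stationary_def
        by (cases "n = 0") (auto simp: state.simps)
      then have "data_matrix F g (S w) w = (\<lambda>n. analysis f w)"
        by (simp add: data_matrix_def flip: analysis_S[OF w]) (simp add: analysis_def)
      then have "Bs_norm (data_matrix F g (S w) w) = ell2_norm (analysis f w)"
        by (simp add: Bs_norm_def)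
      then have "norm w \<le> K * ell2_norm (analysis f w)"
        using R(1)[OF data_matrix_mem_Bs[OF system bessel w], of "S w"]
        by (simp add: R(2)[OF w])
      also have "\<dots> \<le> (\<bar>K\<bar> + 1) * ell2_norm (analysis f w)"
        using ell2_norm_nonneg[OF ell2[OF w]] by (intro mult_right_mono) auto
      finally show ?thesis
        by (simp add: field_simps)
    qed
    have upper: "ell2_norm (analysis f w) \<le> (C * \<bar>M\<bar>) * norm w" if w: "w \<in> W" for w
    proof -
      have "ell2_norm (analysis f w) \<le> C * norm (S w)"
        using C(3)[of "S w"] analysis_S[OF w] by simp
      also have "\<dots> \<le> C * (\<bar>M\<bar> * norm w)"
        using M[OF w] C(1) by (intro mult_left_mono) (smt (verit) mult_right_mono norm_ge_zero)
      finally show ?thesis by (simp add: mult.assoc)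
    qed
    have "0 < inverse (\<bar>K\<bar> + 1)" "0 \<le> C * \<bar>M\<bar>"
      using C(1) by auto
    with fW ell2 lower upper show ?thesis
      unfolding frame_for_iff by blast
  qed
  moreover have "stably_recoverable W F g" if "frame_for W f"
  proof (rule frame_left_inverse[OF subspace_W closed_W that])
    fix L :: "(nat \<Rightarrow> complex) \<Rightarrow> 'h" and k :: real
    assume L_add: "\<And>r s. \<lbrakk>r \<in> ell2; s \<in> ell2\<rbrakk> \<Longrightarrow> L (\<lambda>j. r j + s j) = L r + L s"
      and L_scale: "\<And>a r. r \<in> ell2 \<Longrightarrow> L (\<lambda>j. a * r j) = a *\<^sub>C L r"
      and k: "0 \<le> k" and L_bound: "\<And>r. r \<in> ell2 \<Longrightarrow> norm (L r) \<le> k * ell2_norm r"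
      and L_inverse: "\<And>w. w \<in> W \<Longrightarrow> L (analysis f w) = w"
    define R where "R A = L (row_limit A)" for A
    have "norm (R A) \<le> k * Bs_norm A" if "A \<in> Bs" for A
      unfolding R_def
      using L_bound[OF row_limit_mem[OF that]] mult_left_mono[OF norm_row_limit[OF that] k]
      by linarith
    then have "bounded_clinear_Bs R"
      unfolding bounded_clinear_Bs_def
      by (auto simp: R_def row_limit_add row_limit_scale row_limit_mem L_add L_scale)
    moreover have "R (data_matrix F g x0 w) = w" if "w \<in> W" for x0 w
      unfolding R_def row_limit_data_matrix[OF system bessel that] analysis_S[OF that]
      using that by (rule L_inverse)
    ultimately show ?thesis
      unfolding stably_recoverable_def using data_matrix_mem_Bs[OF system bessel] by blast
  qed
  ultimately show ?thesis
    unfolding f_def by blast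
qed

end
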